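(* Let $\mathcal{P}=(M,P,\partial)$ and $\mathcal{P}'=(M',P',\partial')$ be two arbitrary crossed modules of Lie algebras. Then there is a groupoid $HOM(\mathcal{P},\mathcal{P}')$ whose objects are the crossed module morphisms $\mathcal{P}\to\mathcal{P}'$ and in which the morphisms from $f=(f_1,f_0)$ to $g=(g_1,g_0)$ are the homotopies from $f$ to $g$, i.e. the $f_0$-derivations $d:P\to M'$ connecting $f$ to $g$; the composite of $d:f\to g$ and $d':g\to h$ is the pointwise sum $d+d'$, the identity of $f$ is the zero map $P\to M'$, and the inverse of $d$ is $-d$. In particular, the relation on the set of crossed module morphisms $\mathcal{P}\to\mathcal{P}'$ given by $$f\simeq g \iff \text{there exists an } f_0\text{-derivation } d:P\to M' \text{ connecting } f \text{ to } g$$ is an equivalence relation.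
   Context: All Lie algebras are over a fixed commutative ground ring. An action of a Lie algebra $P$ on a Lie algebra $M$ is a bilinear map $P\times M\to M$, $(p,m)\mapsto p\cdot m$, with $[p,p']\cdot m=p\cdot(p'\cdot m)-p'\cdot(p\cdot m)$ and $p\cdot[m,m']=[p\cdot m,m']+[m,p\cdot m']$ for all $m,m'\in M$, $p,p'\in P$. A crossed module of Lie algebras $(M,P,\partial)$ is a Lie algebra homomorphism $\partial:M\to P$ together with an action of $P$ on $M$ such that $\partial(p\cdot m)=[p,\partial(m)]$ and $\partial(m)\cdot m'=[m,m']$ for all $m,m'\in M$, $p\in P$. A morphism of crossed modules $f=(f_1,f_0):(M,P,\partial)\to(M',P',\partial')$ is a pair of Lie algebra morphisms $f_1:M\to M'$, $f_0:P\to P'$ such that $f_1(p\cdot m)=f_0(p)\cdot f_1(m)$ and $\partial'f_1(m)=f_0\partial(m)$ for all $m\in M$, $p\in P$. Given such a morphism $f$, an $f_0$-derivation is a linear map $d:P\to M'$ such that $d[p,p']=f_0(p)\cdot d(p')-f_0(p')\cdot d(p)+[d(p),d(p')]$ for all $p,p'\in P$. For crossed module morphisms $f=(f_1,f_0)$ and $g=(g_1,g_0)$ from $\mathcal{P}$ to $\mathcal{P}'$, a linear map $d:P\to M'$ connects $f$ to $g$ if $g_0(p)=f_0(p)+\partial'd(p)$ for all $p\in P$ and $g_1(m)=f_1(m)+d\partial(m)$ for all $m\in M$. *)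

theory Defs
  imports "HOL-Algebra.Module"
begin

section \<open>Lie algebras over a commutative ring\<close>

text \<open>The fields for the multiplication and unit of a ring, which HOL-Algebra's module record
  inherits, are unused here, as they are for modules.\<close>

record ('k, 'a) lie_alg = "('k, 'a) module" +
  bracket :: "'a \<Rightarrow> 'a \<Rightarrow> 'a"

definition is_linear :: "('k, 'r) ring_scheme \<Rightarrow> ('k, 'a) lie_alg \<Rightarrow> ('k, 'b) lie_alg \<Rightarrow> ('a \<Rightarrow> 'b) \<Rightarrow> bool"
  where "is_linear k A B f \<longleftrightarrow>
    f \<in> carrier A \<rightarrow> carrier B \<and>
    (\<forall>x\<in>carrier A. \<forall>y\<in>carrier A. f (x \<oplus>\<^bsub>A\<^esub> y) = f x \<oplus>\<^bsub>B\<^esub> f y) \<and>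
    (\<forall>c\<in>carrier k. \<forall>x\<in>carrier A. f (c \<odot>\<^bsub>A\<^esub> x) = c \<odot>\<^bsub>B\<^esub> f x)"

definition is_bilinear :: "('k, 'r) ring_scheme \<Rightarrow> ('k, 'a) lie_alg \<Rightarrow> ('k, 'b) lie_alg \<Rightarrow> ('k, 'c) lie_alg
    \<Rightarrow> ('a \<Rightarrow> 'b \<Rightarrow> 'c) \<Rightarrow> bool"
  where "is_bilinear k A B C f \<longleftrightarrow>
    (\<forall>x\<in>carrier A. is_linear k B C (\<lambda>y. f x y)) \<and>
    (\<forall>y\<in>carrier B. is_linear k A C (\<lambda>x. f x y))"

locale lie_algebra = module k L
  for k :: "('k, 'r) ring_scheme" and L :: "('k, 'a) lie_alg" +
  assumes bracket_bilinear: "is_bilinear k L L L (bracket L)"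
    and bracket_alternating: "x \<in> carrier L \<Longrightarrow> bracket L x x = \<zero>\<^bsub>L\<^esub>"
    and jacobi: "\<lbrakk>x \<in> carrier L; y \<in> carrier L; z \<in> carrier L\<rbrakk> \<Longrightarrow>
      bracket L x (bracket L y z) \<oplus>\<^bsub>L\<^esub> bracket L y (bracket L z x) \<oplus>\<^bsub>L\<^esub> bracket L z (bracket L x y)
        = \<zero>\<^bsub>L\<^esub>"

definition lie_hom :: "('k, 'r) ring_scheme \<Rightarrow> ('k, 'a) lie_alg \<Rightarrow> ('k, 'b) lie_alg \<Rightarrow> ('a \<Rightarrow> 'b) \<Rightarrow> bool"
  where "lie_hom k A B f \<longleftrightarrow> is_linear k A B f \<and>
    (\<forall>x\<in>carrier A. \<forall>y\<in>carrier A. f (bracket A x y) = bracket B (f x) (f y))"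

definition lie_action :: "('k, 'r) ring_scheme \<Rightarrow> ('k, 'p) lie_alg \<Rightarrow> ('k, 'm) lie_alg \<Rightarrow> ('p \<Rightarrow> 'm \<Rightarrow> 'm) \<Rightarrow> bool"
  where "lie_action k P M act \<longleftrightarrow> is_bilinear k P M M act \<and>
    (\<forall>p\<in>carrier P. \<forall>p'\<in>carrier P. \<forall>m\<in>carrier M.
       act (bracket P p p') m = act p (act p' m) \<ominus>\<^bsub>M\<^esub> act p' (act p m)) \<and>
    (\<forall>p\<in>carrier P. \<forall>m\<in>carrier M. \<forall>m'\<in>carrier M.
       act p (bracket M m m') = bracket M (act p m) m' \<oplus>\<^bsub>M\<^esub> bracket M m (act p m'))"


section \<open>Crossed modules and their morphisms\<close>

text \<open>A crossed module \<open>(M, P, \<partial>)\<close>, with its action of \<open>P\<close> on \<open>M\<close>.\<close>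

record ('k, 'm, 'p) xmod =
  xtop :: "('k, 'm) lie_alg"
  xbase :: "('k, 'p) lie_alg"
  bdry :: "'m \<Rightarrow> 'p"
  xact :: "'p \<Rightarrow> 'm \<Rightarrow> 'm"

locale crossed_module =
  fixes k :: "('k, 'r) ring_scheme" and U :: "('k, 'm, 'p) xmod"
  assumes top_lie: "lie_algebra k (xtop U)"
    and base_lie: "lie_algebra k (xbase U)"
    and bdry_hom: "lie_hom k (xtop U) (xbase U) (bdry U)"
    and action: "lie_action k (xbase U) (xtop U) (xact U)"
    and equivariance: "\<lbrakk>p \<in> carrier (xbase U); m \<in> carrier (xtop U)\<rbrakk> \<Longrightarrow>
      bdry U (xact U p m) = bracket (xbase U) p (bdry U m)"
    and peiffer: "\<lbrakk>m \<in> carrier (xtop U); m' \<in> carrier (xtop U)\<rbrakk> \<Longrightarrow>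
      xact U (bdry U m) m' = bracket (xtop U) m m'"

text \<open>Functions are total in HOL; requiring the maps to be extensional (\<open>undefined\<close> outside the
  carrier) makes equality of functions coincide with equality of maps between the carriers.
  A morphism is the pair \<open>(f\<^sub>1, f\<^sub>0)\<close>.\<close>

definition xmod_homs :: "('k, 'r) ring_scheme \<Rightarrow> ('k, 'm, 'p) xmod \<Rightarrow> ('k, 'n, 'q) xmod
    \<Rightarrow> (('m \<Rightarrow> 'n) \<times> ('p \<Rightarrow> 'q)) set"
  where "xmod_homs k U V = {(f1, f0).
    f1 \<in> extensional (carrier (xtop U)) \<and> f0 \<in> extensional (carrier (xbase U)) \<and>
    lie_hom k (xtop U) (xtop V) f1 \<and> lie_hom k (xbase U) (xbase V) f0 \<and>
    (\<forall>p\<in>carrier (xbase U). \<forall>m\<in>carrier (xtop U). f1 (xact U p m) = xact V (f0 p) (f1 m)) \<and>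
    (\<forall>m\<in>carrier (xtop U). bdry V (f1 m) = f0 (bdry U m))}"

definition derivations :: "('k, 'r) ring_scheme \<Rightarrow> ('k, 'm, 'p) xmod \<Rightarrow> ('k, 'n, 'q) xmod
    \<Rightarrow> ('p \<Rightarrow> 'q) \<Rightarrow> ('p \<Rightarrow> 'n) set"
  where "derivations k U V f0 = {d \<in> extensional (carrier (xbase U)).
    is_linear k (xbase U) (xtop V) d \<and>
    (\<forall>p\<in>carrier (xbase U). \<forall>p'\<in>carrier (xbase U).
       d (bracket (xbase U) p p') =
         (xact V (f0 p) (d p') \<ominus>\<^bsub>xtop V\<^esub> xact V (f0 p') (d p)) \<oplus>\<^bsub>xtop V\<^esub> bracket (xtop V) (d p) (d p'))}"

definition connects :: "('k, 'm, 'p) xmod \<Rightarrow> ('k, 'n, 'q) xmod \<Rightarrow> ('m \<Rightarrow> 'n) \<times> ('p \<Rightarrow> 'q)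
    \<Rightarrow> ('m \<Rightarrow> 'n) \<times> ('p \<Rightarrow> 'q) \<Rightarrow> ('p \<Rightarrow> 'n) \<Rightarrow> bool"
  where "connects U V f g d \<longleftrightarrow>
    (\<forall>p\<in>carrier (xbase U). snd g p = snd f p \<oplus>\<^bsub>xbase V\<^esub> bdry V (d p)) \<and>
    (\<forall>m\<in>carrier (xtop U). fst g m = fst f m \<oplus>\<^bsub>xtop V\<^esub> d (bdry U m))"

definition homotopies :: "('k, 'r) ring_scheme \<Rightarrow> ('k, 'm, 'p) xmod \<Rightarrow> ('k, 'n, 'q) xmod
    \<Rightarrow> ('m \<Rightarrow> 'n) \<times> ('p \<Rightarrow> 'q) \<Rightarrow> ('m \<Rightarrow> 'n) \<times> ('p \<Rightarrow> 'q) \<Rightarrow> ('p \<Rightarrow> 'n) set"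
  where "homotopies k U V f g = {d \<in> derivations k U V (snd f). connects U V f g d}"


section \<open>Groupoids\<close>

text \<open>A small groupoid presented by its hom-sets. These need not be disjoint, so composition,
  identities and inverses carry the objects as arguments; \<open>cmp f g h a b\<close> is the composite of
  \<open>a : f \<rightarrow> g\<close> followed by \<open>b : g \<rightarrow> h\<close>.\<close>

locale groupoid =
  fixes Obj :: "'o set"
    and Hom :: "'o \<Rightarrow> 'o \<Rightarrow> 'a set"
    and cmp :: "'o \<Rightarrow> 'o \<Rightarrow> 'o \<Rightarrow> 'a \<Rightarrow> 'a \<Rightarrow> 'a"
    and idt :: "'o \<Rightarrow> 'a"
    and ivs :: "'o \<Rightarrow> 'o \<Rightarrow> 'a \<Rightarrow> 'a"
  assumes cmp_closed: "\<lbrakk>f \<in> Obj; g \<in> Obj; h \<in> Obj; a \<in> Hom f g; b \<in> Hom g h\<rbrakk> \<Longrightarrow> cmp f g h a b \<in> Hom f h"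
    and idt_closed: "f \<in> Obj \<Longrightarrow> idt f \<in> Hom f f"
    and ivs_closed: "\<lbrakk>f \<in> Obj; g \<in> Obj; a \<in> Hom f g\<rbrakk> \<Longrightarrow> ivs f g a \<in> Hom g f"
    and cmp_assoc: "\<lbrakk>e \<in> Obj; f \<in> Obj; g \<in> Obj; h \<in> Obj; a \<in> Hom e f; b \<in> Hom f g; c \<in> Hom g h\<rbrakk> \<Longrightarrow>
      cmp e g h (cmp e f g a b) c = cmp e f h a (cmp f g h b c)"
    and idt_left: "\<lbrakk>f \<in> Obj; g \<in> Obj; a \<in> Hom f g\<rbrakk> \<Longrightarrow> cmp f f g (idt f) a = a"
    and idt_right: "\<lbrakk>f \<in> Obj; g \<in> Obj; a \<in> Hom f g\<rbrakk> \<Longrightarrow> cmp f g g a (idt g) = a"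
    and ivs_right: "\<lbrakk>f \<in> Obj; g \<in> Obj; a \<in> Hom f g\<rbrakk> \<Longrightarrow> cmp f g f a (ivs f g a) = idt f"
    and ivs_left: "\<lbrakk>f \<in> Obj; g \<in> Obj; a \<in> Hom f g\<rbrakk> \<Longrightarrow> cmp g f g (ivs f g a) a = idt g"

end

theory Submission
  imports Defs
begin

text \<open>A homotopy \<open>d : f \<rightarrow> g\<close> satisfies \<open>g\<^sub>0 p = f\<^sub>0 p + \<partial>' (d p)\<close>, so the Peiffer identity gives
  \<open>g\<^sub>0 p \<cdot> n = f\<^sub>0 p \<cdot> n + [d p, n]\<close>: the actions of \<open>P\<close> on \<open>M'\<close> through \<open>f\<^sub>0\<close> and through \<open>g\<^sub>0\<close>
  differ by a bracket with \<open>d p\<close> (lemma \<open>xact_target\<close>). This turns a statement about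
  \<open>g\<^sub>0\<close>-derivations into one about \<open>f\<^sub>0\<close>. If \<open>d'\<close> is a \<open>g\<^sub>0\<close>-derivation, rewriting its derivation law
  in this way creates the terms \<open>[d p, d' p']\<close> and \<open>[d' p, d p']\<close>. They are exactly the cross terms of
  \<open>[(d + d') p, (d + d') p']\<close>, so \<open>d + d'\<close> is an \<open>f\<^sub>0\<close>-derivation (lemma \<open>homotopy_add\<close>). For \<open>-d\<close>
  the two corrections contribute \<open>-2 [d p, d p']\<close> to the law, and the quadratic term
  \<open>[-d p, -d p'] = [d p, d p']\<close> brings this to \<open>-[d p, d p']\<close>, as required (lemma
  \<open>homotopy_uminus\<close>).

  Everything else holds pointwise: the groupoid laws are those of the abelian group \<open>M'\<close>, and
  \<open>\<simeq>\<close> is the connectedness relation of the groupoid.\<close>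

section \<open>Linear maps\<close>

lemma is_linearI:
  assumes "\<And>x. x \<in> carrier A \<Longrightarrow> f x \<in> carrier B"
    and "\<And>x y. \<lbrakk>x \<in> carrier A; y \<in> carrier A\<rbrakk> \<Longrightarrow> f (x \<oplus>\<^bsub>A\<^esub> y) = f x \<oplus>\<^bsub>B\<^esub> f y"
    and "\<And>c x. \<lbrakk>c \<in> carrier k; x \<in> carrier A\<rbrakk> \<Longrightarrow> f (c \<odot>\<^bsub>A\<^esub> x) = c \<odot>\<^bsub>B\<^esub> f x"
  shows "is_linear k A B f"
  using assms by (auto simp: is_linear_def)

lemma is_linear_closed: "\<lbrakk>is_linear k A B f; x \<in> carrier A\<rbrakk> \<Longrightarrow> f x \<in> carrier B"
  by (auto simp: is_linear_def)

lemma is_linear_add: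
  "\<lbrakk>is_linear k A B f; x \<in> carrier A; y \<in> carrier A\<rbrakk> \<Longrightarrow> f (x \<oplus>\<^bsub>A\<^esub> y) = f x \<oplus>\<^bsub>B\<^esub> f y"
  by (auto simp: is_linear_def)

lemma is_linear_smult:
  "\<lbrakk>is_linear k A B f; c \<in> carrier k; x \<in> carrier A\<rbrakk> \<Longrightarrow> f (c \<odot>\<^bsub>A\<^esub> x) = c \<odot>\<^bsub>B\<^esub> f x"
  by (auto simp: is_linear_def)

lemma is_linear_zero:
  assumes "module k A" "module k B" "is_linear k A B f"
  shows "f \<zero>\<^bsub>A\<^esub> = \<zero>\<^bsub>B\<^esub>"
proof -
  interpret A: module k A by fact
  interpret B: module k B by fact
  have "f \<zero>\<^bsub>A\<^esub> \<oplus>\<^bsub>B\<^esub> f \<zero>\<^bsub>A\<^esub> = f \<zero>\<^bsub>A\<^esub>"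
    using is_linear_add[OF assms(3), of "\<zero>\<^bsub>A\<^esub>" "\<zero>\<^bsub>A\<^esub>"] by simp
  then show ?thesis
    using is_linear_closed[OF assms(3), of "\<zero>\<^bsub>A\<^esub>"] by (simp add: B.add.l_cancel_one')
qed

lemma is_linear_uminus:
  assumes "module k A" "module k B" "is_linear k A B f" and x: "x \<in> carrier A"
  shows "f (\<ominus>\<^bsub>A\<^esub> x) = \<ominus>\<^bsub>B\<^esub> f x"
proof -
  interpret A: module k A by fact
  interpret B: module k B by fact
  have "f (\<ominus>\<^bsub>A\<^esub> x) \<oplus>\<^bsub>B\<^esub> f x = \<zero>\<^bsub>B\<^esub>"
    using is_linear_add[OF assms(3), of "\<ominus>\<^bsub>A\<^esub> x" x] is_linear_zero[OF assms(1-3)] x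
    by (simp add: A.l_neg)
  then show ?thesis
    using is_linear_closed[OF assms(3)] x by (intro B.minus_equality[symmetric]) auto
qed

lemma is_bilinear_left: "\<lbrakk>is_bilinear k A B C f; y \<in> carrier B\<rbrakk> \<Longrightarrow> is_linear k A C (\<lambda>x. f x y)"
  by (auto simp: is_bilinear_def)

lemma is_bilinear_right: "\<lbrakk>is_bilinear k A B C f; x \<in> carrier A\<rbrakk> \<Longrightarrow> is_linear k B C (f x)"
  by (auto simp: is_bilinear_def)


section \<open>Rules for the bracket and the action\<close>

context lie_algebra
begin

lemma bracket_closed [simp]:
  "\<lbrakk>x \<in> carrier L; y \<in> carrier L\<rbrakk> \<Longrightarrow> bracket L x y \<in> carrier L"
  using is_linear_closed[OF is_bilinear_right[OF bracket_bilinear]] .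

lemma bracket_add_left:
  "\<lbrakk>x \<in> carrier L; y \<in> carrier L; z \<in> carrier L\<rbrakk> \<Longrightarrow>
    bracket L (x \<oplus>\<^bsub>L\<^esub> y) z = bracket L x z \<oplus>\<^bsub>L\<^esub> bracket L y z"
  using is_linear_add[OF is_bilinear_left[OF bracket_bilinear]] .

lemma bracket_add_right:
  "\<lbrakk>x \<in> carrier L; y \<in> carrier L; z \<in> carrier L\<rbrakk> \<Longrightarrow>
    bracket L x (y \<oplus>\<^bsub>L\<^esub> z) = bracket L x y \<oplus>\<^bsub>L\<^esub> bracket L x z"
  using is_linear_add[OF is_bilinear_right[OF bracket_bilinear]] .

lemma bracket_uminus_left:
  "\<lbrakk>x \<in> carrier L; y \<in> carrier L\<rbrakk> \<Longrightarrow> bracket L (\<ominus>\<^bsub>L\<^esub> x) y = \<ominus>\<^bsub>L\<^esub> bracket L x y"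
  using is_linear_uminus[OF module_axioms module_axioms is_bilinear_left[OF bracket_bilinear]] .

lemma bracket_uminus_right:
  "\<lbrakk>x \<in> carrier L; y \<in> carrier L\<rbrakk> \<Longrightarrow> bracket L x (\<ominus>\<^bsub>L\<^esub> y) = \<ominus>\<^bsub>L\<^esub> bracket L x y"
  using is_linear_uminus[OF module_axioms module_axioms is_bilinear_right[OF bracket_bilinear]] .

lemma bracket_antisym:
  assumes "x \<in> carrier L" "y \<in> carrier L"
  shows "bracket L y x = \<ominus>\<^bsub>L\<^esub> bracket L x y"
proof -
  \<comment> \<open>Expand \<open>[x + y, x + y] = 0\<close>.\<close>
  have "bracket L (x \<oplus>\<^bsub>L\<^esub> y) (x \<oplus>\<^bsub>L\<^esub> y) = bracket L y x \<oplus>\<^bsub>L\<^esub> bracket L x y"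
    using assms by (simp add: bracket_add_left bracket_add_right bracket_alternating[of x]
        bracket_alternating[of y] M.a_comm)
  then have "bracket L y x \<oplus>\<^bsub>L\<^esub> bracket L x y = \<zero>\<^bsub>L\<^esub>"
    using assms by (simp add: bracket_alternating)
  then show ?thesis
    using assms by (intro minus_equality[symmetric]) auto
qed

end

context crossed_module
begin

sublocale top: lie_algebra k "xtop U" by (rule top_lie)
sublocale base: lie_algebra k "xbase U" by (rule base_lie)

lemma bdry_linear: "is_linear k (xtop U) (xbase U) (bdry U)"
  using bdry_hom by (simp add: lie_hom_def)

lemma bdry_closed [simp]: "m \<in> carrier (xtop U) \<Longrightarrow> bdry U m \<in> carrier (xbase U)"
  using is_linear_closed[OF bdry_linear] .

lemma xact_bilinear: "is_bilinear k (xbase U) (xtop U) (xtop U) (xact U)"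
  using action by (simp add: lie_action_def)

lemma xact_closed [simp]:
  "\<lbrakk>p \<in> carrier (xbase U); m \<in> carrier (xtop U)\<rbrakk> \<Longrightarrow> xact U p m \<in> carrier (xtop U)"
  using is_linear_closed[OF is_bilinear_right[OF xact_bilinear]] .

lemma xact_add_left:
  "\<lbrakk>p \<in> carrier (xbase U); p' \<in> carrier (xbase U); m \<in> carrier (xtop U)\<rbrakk> \<Longrightarrow>
    xact U (p \<oplus>\<^bsub>xbase U\<^esub> p') m = xact U p m \<oplus>\<^bsub>xtop U\<^esub> xact U p' m"
  using is_linear_add[OF is_bilinear_left[OF xact_bilinear]] .

lemma xact_add_right:
  "\<lbrakk>p \<in> carrier (xbase U); m \<in> carrier (xtop U); m' \<in> carrier (xtop U)\<rbrakk> \<Longrightarrow>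
    xact U p (m \<oplus>\<^bsub>xtop U\<^esub> m') = xact U p m \<oplus>\<^bsub>xtop U\<^esub> xact U p m'"
  using is_linear_add[OF is_bilinear_right[OF xact_bilinear]] .

lemma xact_zero_right: "p \<in> carrier (xbase U) \<Longrightarrow> xact U p \<zero>\<^bsub>xtop U\<^esub> = \<zero>\<^bsub>xtop U\<^esub>"
  using is_linear_zero[OF top.module_axioms top.module_axioms is_bilinear_right[OF xact_bilinear]] .

lemma xact_uminus_right:
  "\<lbrakk>p \<in> carrier (xbase U); m \<in> carrier (xtop U)\<rbrakk> \<Longrightarrow>
    xact U p (\<ominus>\<^bsub>xtop U\<^esub> m) = \<ominus>\<^bsub>xtop U\<^esub> xact U p m"
  using is_linear_uminus[OF top.module_axioms top.module_axioms
      is_bilinear_right[OF xact_bilinear]] .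

end


section \<open>Homotopies between crossed module morphisms\<close>

locale crossed_module_pair =
  src: crossed_module k U + tgt: crossed_module k V
  for k :: "('k, 'r) ring_scheme"
    and U :: "('k, 'm, 'p) xmod" and V :: "('k, 'n, 'q) xmod"
begin

lemma xmod_homs_closed:
  assumes "f \<in> xmod_homs k U V"
  shows "p \<in> carrier (xbase U) \<Longrightarrow> snd f p \<in> carrier (xbase V)"
    and "m \<in> carrier (xtop U) \<Longrightarrow> fst f m \<in> carrier (xtop V)"
  using assms by (auto simp: xmod_homs_def lie_hom_def is_linear_def)

lemma homotopies_linear: "d \<in> homotopies k U V f g \<Longrightarrow> is_linear k (xbase U) (xtop V) d"
  by (simp add: homotopies_def derivations_def)

lemma homotopies_closed:
  "\<lbrakk>d \<in> homotopies k U V f g; p \<in> carrier (xbase U)\<rbrakk> \<Longrightarrow> d p \<in> carrier (xtop V)"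
  using is_linear_closed[OF homotopies_linear] .

lemma homotopies_extensional: "d \<in> homotopies k U V f g \<Longrightarrow> d \<in> extensional (carrier (xbase U))"
  by (simp add: homotopies_def derivations_def)

lemma homotopies_derivation:
  "\<lbrakk>d \<in> homotopies k U V f g; p \<in> carrier (xbase U); p' \<in> carrier (xbase U)\<rbrakk> \<Longrightarrow>
    d (bracket (xbase U) p p') =
      (xact V (snd f p) (d p') \<ominus>\<^bsub>xtop V\<^esub> xact V (snd f p') (d p))
        \<oplus>\<^bsub>xtop V\<^esub> bracket (xtop V) (d p) (d p')"
  by (simp add: homotopies_def derivations_def)

lemma homotopies_target_base:
  "\<lbrakk>d \<in> homotopies k U V f g; p \<in> carrier (xbase U)\<rbrakk> \<Longrightarrow>
    snd g p = snd f p \<oplus>\<^bsub>xbase V\<^esub> bdry V (d p)"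
  by (simp add: homotopies_def connects_def)

lemma homotopies_target_top:
  "\<lbrakk>d \<in> homotopies k U V f g; m \<in> carrier (xtop U)\<rbrakk> \<Longrightarrow>
    fst g m = fst f m \<oplus>\<^bsub>xtop V\<^esub> d (bdry U m)"
  by (simp add: homotopies_def connects_def)

lemma homotopiesI:
  fixes e :: "'p \<Rightarrow> 'n"
  assumes "\<And>p. p \<in> carrier (xbase U) \<Longrightarrow> e p \<in> carrier (xtop V)"
    and "\<And>p q. \<lbrakk>p \<in> carrier (xbase U); q \<in> carrier (xbase U)\<rbrakk> \<Longrightarrow>
      e (p \<oplus>\<^bsub>xbase U\<^esub> q) = e p \<oplus>\<^bsub>xtop V\<^esub> e q"
    and "\<And>c p. \<lbrakk>c \<in> carrier k; p \<in> carrier (xbase U)\<rbrakk> \<Longrightarrow>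
      e (c \<odot>\<^bsub>xbase U\<^esub> p) = c \<odot>\<^bsub>xtop V\<^esub> e p"
    and "\<And>p q. \<lbrakk>p \<in> carrier (xbase U); q \<in> carrier (xbase U)\<rbrakk> \<Longrightarrow>
      e (bracket (xbase U) p q) =
        (xact V (snd f p) (e q) \<ominus>\<^bsub>xtop V\<^esub> xact V (snd f q) (e p))
          \<oplus>\<^bsub>xtop V\<^esub> bracket (xtop V) (e p) (e q)"
    and "\<And>p. p \<in> carrier (xbase U) \<Longrightarrow> snd g p = snd f p \<oplus>\<^bsub>xbase V\<^esub> bdry V (e p)"
    and "\<And>m. m \<in> carrier (xtop U) \<Longrightarrow> fst g m = fst f m \<oplus>\<^bsub>xtop V\<^esub> e (bdry U m)"
  shows "(\<lambda>p\<in>carrier (xbase U). e p) \<in> homotopies k U V f g"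
  using assms
  by (auto simp: homotopies_def derivations_def connects_def intro!: is_linearI)

text \<open>The Peiffer identity \<open>\<partial>' n \<cdot> n' = [n, n']\<close> converts the difference \<open>\<partial>' (d p)\<close> of the two base
  maps, which acts on \<open>M'\<close>, into a bracket inside \<open>M'\<close>. This is how derivations over different
  morphisms are compared.\<close>

lemma xact_target:
  assumes "f \<in> xmod_homs k U V" and "d \<in> homotopies k U V f g"
    and "p \<in> carrier (xbase U)" and "n \<in> carrier (xtop V)"
  shows "xact V (snd g p) n = xact V (snd f p) n \<oplus>\<^bsub>xtop V\<^esub> bracket (xtop V) (d p) n"
  using assms xmod_homs_closed[OF assms(1)] homotopies_closed[OF assms(2)]
  by (simp add: homotopies_target_base[OF assms(2)] tgt.xact_add_left tgt.peiffer)

lemma homotopy_zero: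
  assumes f: "f \<in> xmod_homs k U V"
  shows "(\<lambda>p\<in>carrier (xbase U). \<zero>\<^bsub>xtop V\<^esub>) \<in> homotopies k U V f f"
proof (rule homotopiesI)
  fix p q assume "p \<in> carrier (xbase U)" "q \<in> carrier (xbase U)"
  then show "\<zero>\<^bsub>xtop V\<^esub> =
      (xact V (snd f p) \<zero>\<^bsub>xtop V\<^esub> \<ominus>\<^bsub>xtop V\<^esub> xact V (snd f q) \<zero>\<^bsub>xtop V\<^esub>)
        \<oplus>\<^bsub>xtop V\<^esub> bracket (xtop V) \<zero>\<^bsub>xtop V\<^esub> \<zero>\<^bsub>xtop V\<^esub>"
    by (simp add: xmod_homs_closed[OF f] tgt.xact_zero_right tgt.top.bracket_alternating
        tgt.top.minus_eq tgt.top.r_neg)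
next
  show "snd f p = snd f p \<oplus>\<^bsub>xbase V\<^esub> bdry V \<zero>\<^bsub>xtop V\<^esub>" if "p \<in> carrier (xbase U)" for p
    using that is_linear_zero[OF tgt.top.module_axioms tgt.base.module_axioms tgt.bdry_linear]
    by (simp add: xmod_homs_closed[OF f])
qed (simp_all add: xmod_homs_closed[OF f])

text \<open>Moving the derivation law of \<open>d'\<close> from \<open>g\<close> to \<open>f\<close> costs \<open>[d p, d' p'] - [d p', d' p]\<close>. By
  antisymmetry this is \<open>[d p, d' p'] + [d' p, d p']\<close>, the mixed part of the bracket of
  \<open>d p + d' p\<close> with \<open>d p' + d' p'\<close>.\<close>

lemma homotopy_add:
  assumes f: "f \<in> xmod_homs k U V" and g: "g \<in> xmod_homs k U V"
    and d: "d \<in> homotopies k U V f g" and d': "d' \<in> homotopies k U V g h"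
  shows "(\<lambda>p\<in>carrier (xbase U). d p \<oplus>\<^bsub>xtop V\<^esub> d' p) \<in> homotopies k U V f h"
proof (rule homotopiesI)
  note closed [simp] = xmod_homs_closed[OF f] xmod_homs_closed[OF g]
    homotopies_closed[OF d] homotopies_closed[OF d']
  fix p assume p: "p \<in> carrier (xbase U)"
  show "d p \<oplus>\<^bsub>xtop V\<^esub> d' p \<in> carrier (xtop V)"
    using p by simp
  show "snd h p = snd f p \<oplus>\<^bsub>xbase V\<^esub> bdry V (d p \<oplus>\<^bsub>xtop V\<^esub> d' p)"
    using p by (simp add: homotopies_target_base[OF d] homotopies_target_base[OF d']
        is_linear_add[OF tgt.bdry_linear] tgt.base.M.a_assoc)
  show "d (c \<odot>\<^bsub>xbase U\<^esub> p) \<oplus>\<^bsub>xtop V\<^esub> d' (c \<odot>\<^bsub>xbase U\<^esub> p) =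
      c \<odot>\<^bsub>xtop V\<^esub> (d p \<oplus>\<^bsub>xtop V\<^esub> d' p)" if "c \<in> carrier k" for c
    using p that by (simp add: is_linear_smult[OF homotopies_linear[OF d]]
        is_linear_smult[OF homotopies_linear[OF d']] tgt.top.smult_r_distr)
  fix q assume q: "q \<in> carrier (xbase U)"
  show "d (p \<oplus>\<^bsub>xbase U\<^esub> q) \<oplus>\<^bsub>xtop V\<^esub> d' (p \<oplus>\<^bsub>xbase U\<^esub> q) =
      (d p \<oplus>\<^bsub>xtop V\<^esub> d' p) \<oplus>\<^bsub>xtop V\<^esub> (d q \<oplus>\<^bsub>xtop V\<^esub> d' q)"
    using p q by (simp add: is_linear_add[OF homotopies_linear[OF d]]
        is_linear_add[OF homotopies_linear[OF d']] tgt.top.M.a_ac)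
  show "d (bracket (xbase U) p q) \<oplus>\<^bsub>xtop V\<^esub> d' (bracket (xbase U) p q) =
      (xact V (snd f p) (d q \<oplus>\<^bsub>xtop V\<^esub> d' q)
          \<ominus>\<^bsub>xtop V\<^esub> xact V (snd f q) (d p \<oplus>\<^bsub>xtop V\<^esub> d' p))
        \<oplus>\<^bsub>xtop V\<^esub> bracket (xtop V) (d p \<oplus>\<^bsub>xtop V\<^esub> d' p) (d q \<oplus>\<^bsub>xtop V\<^esub> d' q)"
    using p q
    by (simp add: homotopies_derivation[OF d] homotopies_derivation[OF d'] xact_target[OF f d]
        tgt.xact_add_right tgt.top.bracket_add_left tgt.top.bracket_add_right
        tgt.top.bracket_antisym[of "d q" "d' p"] tgt.top.minus_eq tgt.top.minus_add tgt.top.M.a_ac)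
next
  fix m assume m: "m \<in> carrier (xtop U)"
  then show "fst h m = fst f m \<oplus>\<^bsub>xtop V\<^esub> (d (bdry U m) \<oplus>\<^bsub>xtop V\<^esub> d' (bdry U m))"
    by (simp add: homotopies_target_top[OF d] homotopies_target_top[OF d'] tgt.top.M.a_assoc
        xmod_homs_closed[OF f] homotopies_closed[OF d] homotopies_closed[OF d'])
qed

lemma homotopy_uminus:
  assumes f: "f \<in> xmod_homs k U V" and d: "d \<in> homotopies k U V f g"
  shows "(\<lambda>p\<in>carrier (xbase U). \<ominus>\<^bsub>xtop V\<^esub> d p) \<in> homotopies k U V g f"
proof (rule homotopiesI)
  note closed [simp] = xmod_homs_closed[OF f] homotopies_closed[OF d]
  fix p assume p: "p \<in> carrier (xbase U)"
  show "\<ominus>\<^bsub>xtop V\<^esub> d p \<in> carrier (xtop V)"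
    using p by simp
  show "snd f p = snd g p \<oplus>\<^bsub>xbase V\<^esub> bdry V (\<ominus>\<^bsub>xtop V\<^esub> d p)"
    using p by (simp add: homotopies_target_base[OF d] tgt.base.M.a_assoc tgt.base.r_neg
        is_linear_uminus[OF tgt.top.module_axioms tgt.base.module_axioms tgt.bdry_linear])
  show "\<ominus>\<^bsub>xtop V\<^esub> d (c \<odot>\<^bsub>xbase U\<^esub> p) = c \<odot>\<^bsub>xtop V\<^esub> (\<ominus>\<^bsub>xtop V\<^esub> d p)" if "c \<in> carrier k" for c
    using p that by (simp add: is_linear_smult[OF homotopies_linear[OF d]] tgt.top.smult_r_minus)
  fix q assume q: "q \<in> carrier (xbase U)"
  show "\<ominus>\<^bsub>xtop V\<^esub> d (p \<oplus>\<^bsub>xbase U\<^esub> q) = \<ominus>\<^bsub>xtop V\<^esub> d p \<oplus>\<^bsub>xtop V\<^esub> \<ominus>\<^bsub>xtop V\<^esub> d q"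
    using p q by (simp add: is_linear_add[OF homotopies_linear[OF d]] tgt.top.minus_add)
  have cancel: "b \<oplus>\<^bsub>xtop V\<^esub> (x \<oplus>\<^bsub>xtop V\<^esub> (\<ominus>\<^bsub>xtop V\<^esub> b \<oplus>\<^bsub>xtop V\<^esub> y)) = x \<oplus>\<^bsub>xtop V\<^esub> y"
    if "b \<in> carrier (xtop V)" "x \<in> carrier (xtop V)" "y \<in> carrier (xtop V)" for b x y
    using that by (simp add: tgt.top.M.a_lcomm[of b x] tgt.top.r_neg2)
  \<comment> \<open>Of the three brackets, the corrections from \<open>xact_target\<close> give \<open>-[d p, d q] + [d q, d p]\<close>;
    the second cancels against the quadratic term \<open>[-d p, -d q]\<close>.\<close>
  show "\<ominus>\<^bsub>xtop V\<^esub> d (bracket (xbase U) p q) =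
      (xact V (snd g p) (\<ominus>\<^bsub>xtop V\<^esub> d q) \<ominus>\<^bsub>xtop V\<^esub> xact V (snd g q) (\<ominus>\<^bsub>xtop V\<^esub> d p))
        \<oplus>\<^bsub>xtop V\<^esub> bracket (xtop V) (\<ominus>\<^bsub>xtop V\<^esub> d p) (\<ominus>\<^bsub>xtop V\<^esub> d q)"
    using p q
    by (simp add: homotopies_derivation[OF d] xact_target[OF f d] tgt.xact_uminus_right
        tgt.top.bracket_uminus_left tgt.top.bracket_uminus_right
        tgt.top.bracket_antisym[of "d p" "d q"] tgt.top.minus_eq tgt.top.minus_add
        tgt.top.M.a_ac cancel)
next
  fix m assume m: "m \<in> carrier (xtop U)"
  then show "fst f m = fst g m \<oplus>\<^bsub>xtop V\<^esub> \<ominus>\<^bsub>xtop V\<^esub> d (bdry U m)"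
    by (simp add: homotopies_target_top[OF d] tgt.top.M.a_assoc tgt.top.r_neg
        xmod_homs_closed[OF f] homotopies_closed[OF d])
qed

lemma homotopy_groupoid:
  "groupoid (xmod_homs k U V) (homotopies k U V)
    (\<lambda>f g h d d'. \<lambda>p\<in>carrier (xbase U). d p \<oplus>\<^bsub>xtop V\<^esub> d' p)
    (\<lambda>f. \<lambda>p\<in>carrier (xbase U). \<zero>\<^bsub>xtop V\<^esub>)
    (\<lambda>f g d. \<lambda>p\<in>carrier (xbase U). \<ominus>\<^bsub>xtop V\<^esub> d p)"
proof (unfold_locales, goal_cases)
  case 1 then show ?case by (blast intro: homotopy_add)
next
  case 2 then show ?case by (rule homotopy_zero)
next
  case 3 then show ?case by (blast intro: homotopy_uminus)
next
  case 4 then show ?case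
    by (auto intro!: restrict_ext simp: homotopies_closed tgt.top.M.a_assoc)
next
  case (5 f g d) then show ?case
    by (intro extensionalityI[OF restrict_extensional homotopies_extensional])
      (auto simp: homotopies_closed)
next
  case (6 f g d) then show ?case
    by (intro extensionalityI[OF restrict_extensional homotopies_extensional])
      (auto simp: homotopies_closed)
next
  case 7 then show ?case
    by (auto intro!: restrict_ext simp: homotopies_closed tgt.top.r_neg)
next
  case 8 then show ?case
    by (auto intro!: restrict_ext simp: homotopies_closed tgt.top.l_neg)
qed

end


section \<open>The homotopy groupoid\<close>

lemma (in groupoid) equiv_connected:
  "equiv Obj {(f, g). f \<in> Obj \<and> g \<in> Obj \<and> Hom f g \<noteq> {}}"
proof (rule equivI)
  show "sym {(f, g). f \<in> Obj \<and> g \<in> Obj \<and> Hom f g \<noteq> {}}"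
    by (auto intro!: symI dest: ivs_closed)
  show "trans {(f, g). f \<in> Obj \<and> g \<in> Obj \<and> Hom f g \<noteq> {}}"
    using cmp_closed by (fastforce intro!: transI)
qed (use idt_closed in \<open>auto simp: refl_on_def\<close>)

theorem theorem4p4:
  fixes k :: "('k, 'r) ring_scheme"
    and U :: "('k, 'm, 'p) xmod" and V :: "('k, 'n, 'q) xmod"
  assumes "crossed_module k U" and "crossed_module k V"
  shows "groupoid (xmod_homs k U V) (homotopies k U V)
      (\<lambda>f g h d d'. \<lambda>p\<in>carrier (xbase U). d p \<oplus>\<^bsub>xtop V\<^esub> d' p)
      (\<lambda>f. \<lambda>p\<in>carrier (xbase U). \<zero>\<^bsub>xtop V\<^esub>)
      (\<lambda>f g d. \<lambda>p\<in>carrier (xbase U). \<ominus>\<^bsub>xtop V\<^esub> d p)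
    \<and> equiv (xmod_homs k U V)
      {(f, g). f \<in> xmod_homs k U V \<and> g \<in> xmod_homs k U V \<and>
        (\<exists>d\<in>derivations k U V (snd f). connects U V f g d)}"
proof -
  interpret crossed_module_pair k U V
    by (rule crossed_module_pair.intro[OF assms])
  have "(homotopies k U V f g \<noteq> {}) = (\<exists>d\<in>derivations k U V (snd f). connects U V f g d)" for f g
    by (auto simp: homotopies_def)
  then show ?thesis
    using homotopy_groupoid groupoid.equiv_connected[OF homotopy_groupoid] by simp
qed

end
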